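(* For each integer $n\ge 2$ there exists a map $f:\mathbb{R}^2\to\mathbb{R}^2$ such that: (a) $f$ is a differentiable homeomorphism; (b) $f$ has symmetry group $\mathbb{Z}_n$; (c) $\mathrm{Fix}(f)=\{0\}$; (d) the origin is a local attractor for $f$; (e) there exists a periodic orbit of $f$ of minimal period $n$; and, moreover, $\infty$ is a repellor for $f$.
   Context: $\mathbb{Z}_n$ acts on $\mathbb{R}^2\simeq\mathbb{C}$ as the group generated by the rotation $R_n\cdot z=e^{2\pi i/n}z$ by $2\pi/n$ around the origin. A map $f:\mathbb{R}^2\to\mathbb{R}^2$ is $\mathbb{Z}_n$-equivariant if $f(\gamma x)=\gamma f(x)$ for all $\gamma\in\mathbb{Z}_n$ and $x\in\mathbb{R}^2$. The symmetry group of $f$ is $\mathbb{Z}_n$ if the identity $f(\gamma x)=\gamma f(x)$ for all $x\in\mathbb{R}^2$ holds for an invertible linear map $\gamma$ of $\mathbb{R}^2$ exactly when $\gamma\in\mathbb{Z}_n$. "Differentiable homeomorphism" means a homeomorphism of $\mathbb{R}^2$ onto $\mathbb{R}^2$ that is (Fréchet) differentiable at every point of $\mathbb{R}^2$. $\mathrm{Fix}(f)$ is the set of fixed points of $f$ in $\mathbb{R}^2$. A fixed point is a local attractor if it is asymptotically stable (Lyapunov stable, and attracting all points in some neighbourhood of it under forward iteration). A homeomorphism $f$ of $\mathbb{R}^2$ extends to a homeomorphism of the one-point compactification $\mathbb{R}^2\cup\{\infty\}$ fixing $\infty$; $\infty$ is a repellor for $f$ if it is a local attractor for $f^{-1}$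 (extended in this way). *)

theory Defs
  imports "HOL-Analysis.Analysis"
begin

text \<open>
  The plane is the type \<open>complex\<close>, used as a two-dimensional real normed space: below,
  \<^const>\<open>linear\<close> means real-linear and \<^const>\<open>differentiable\<close> is real Frechet differentiability.
\<close>

definition differentiable_homeomorphism :: "(complex \<Rightarrow> complex) \<Rightarrow> bool" where
  "differentiable_homeomorphism f \<longleftrightarrow>
     (\<exists>g. homeomorphism UNIV UNIV f g) \<and> (\<forall>x. f differentiable (at x))"

definition rotation :: "nat \<Rightarrow> complex \<Rightarrow> complex" where
  "rotation n z = exp (2 * of_real pi * \<i> / of_nat n) * z"

text \<open>The cyclic group generated by \<open>rotation n\<close>: all its integer powers, negative ones included.\<close>

definition rotation_group :: "nat \<Rightarrow> (complex \<Rightarrow> complex) set" where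
  "rotation_group n = {rotation n ^^ k | k. True} \<union> {inv (rotation n) ^^ k | k. True}"

definition symmetry_group :: "(complex \<Rightarrow> complex) \<Rightarrow> (complex \<Rightarrow> complex) set" where
  "symmetry_group f = {\<gamma>. linear \<gamma> \<and> bij \<gamma> \<and> (\<forall>x. f (\<gamma> x) = \<gamma> (f x))}"

definition Fix :: "('a \<Rightarrow> 'a) \<Rightarrow> 'a set" where
  "Fix f = {x. f x = x}"

definition lyapunov_stable :: "'a topology \<Rightarrow> ('a \<Rightarrow> 'a) \<Rightarrow> 'a \<Rightarrow> bool" where
  "lyapunov_stable X f p \<longleftrightarrow>
     (\<forall>U. openin X U \<and> p \<in> U \<longrightarrow>
        (\<exists>V. openin X V \<and> p \<in> V \<and> (\<forall>x\<in>V. \<forall>k. (f ^^ k) x \<in> U)))"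

definition locally_attracting :: "'a topology \<Rightarrow> ('a \<Rightarrow> 'a) \<Rightarrow> 'a \<Rightarrow> bool" where
  "locally_attracting X f p \<longleftrightarrow>
     (\<exists>W. openin X W \<and> p \<in> W \<and> (\<forall>x\<in>W. limitin X (\<lambda>k. (f ^^ k) x) p sequentially))"

definition local_attractor :: "'a topology \<Rightarrow> ('a \<Rightarrow> 'a) \<Rightarrow> 'a \<Rightarrow> bool" where
  "local_attractor X f p \<longleftrightarrow>
     p \<in> topspace X \<and> f p = p \<and> lyapunov_stable X f p \<and> locally_attracting X f p"

text \<open>
  In \<^const>\<open>Alexandroff_compactification\<close> the added point \<open>\<infinity>\<close> is \<^const>\<open>None\<close>, so \<^const>\<open>map_option\<close>
  extends a map of the plane by fixing \<open>\<infinity>\<close>. The definition is meant for homeomorphisms \<open>f\<close>,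
  for which \<open>inv f\<close> is the inverse map.
\<close>

definition infinity_repellor :: "(complex \<Rightarrow> complex) \<Rightarrow> bool" where
  "infinity_repellor f \<longleftrightarrow>
     local_attractor (Alexandroff_compactification euclidean) (map_option (inv f)) None"

definition minimal_period :: "('a \<Rightarrow> 'a) \<Rightarrow> 'a \<Rightarrow> nat \<Rightarrow> bool" where
  "minimal_period f p n \<longleftrightarrow>
     0 < n \<and> (f ^^ n) p = p \<and> (\<forall>k. 0 < k \<and> k < n \<longrightarrow> (f ^^ k) p \<noteq> p)"

end

theory Submission
  imports Defs
begin

text \<open>
  The map is \<open>f z = \<omega> g(z) z\<close> with \<open>\<omega> = e\<^bsup>2 \<pi> \<i> / n\<^esup>\<close> and a positive real gain \<open>g\<close>: it rotates every ray
  from the origin by \<open>2 \<pi> / n\<close> and rescales it. Everything then becomes a question about \<open>g\<close>.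

  Since \<open>n \<ge> 2\<close>, no ray is mapped to itself, so the origin is the only fixed point, whatever \<open>g\<close> is. If
  \<open>g\<close> is invariant under the rotation, the rotation is a symmetry, and a point where \<open>g = 1\<close> has an
  orbit that merely rotates: its minimal period is \<open>n\<close>. If \<open>g < 1\<close> near the origin and near infinity,
  with a margin, the map contracts distances to the origin there, so that the origin attracts and
  infinity repels. So \<open>g\<close> has to be below \<open>1\<close> at both ends and reach \<open>1\<close> in between. The choice is
  \<open>g = 1/2 + m s / (1 + s)\<^sup>2\<close>, where \<open>s = \<bar>z\<bar>\<^sup>2\<close> and the weight \<open>m\<close> between \<open>1\<close> and \<open>5\<close> depends only on the
  direction of \<open>z\<close> (\<open>angular_weight\<close>, \<open>gain\<close>). For such weights the map is strictly increasing along
  each ray (\<open>radial_profile_less\<close>) and therefore a bijection of the plane; a continuous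
  one is a homeomorphism by invariance of domain. It is differentiable at the origin although \<open>g\<close>
  is not smooth there, because \<open>g\<close> is continuous there and multiplies a linear map.

  It remains to see that there are no other linear symmetries \<open>\<gamma>\<close>. Blowing up at the origin, \<open>\<gamma>\<close>
  commutes with the rotation and consequently preserves \<open>g\<close> (\<open>commuting_linear_preserves_gain\<close>). The
  behaviour of \<open>g\<close> along a ray determines both the scale and the weight of the ray
  (\<open>gain_along_ray_determines\<close>), so \<open>\<gamma>\<close> is an isometry preserving \<open>m\<close>. Finally \<open>m\<close> is chosen as
  \<open>3 + cos (n \<phi>) + sin (2 n \<phi>)\<close>, which is invariant under the rotations by multiples of \<open>2 \<pi> / n\<close>
  and no other rotation or reflection (\<open>symmetry_group_subset_rotation_group\<close>).
\<close>

section \<open>Attraction at the origin and at infinity\<close>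

lemma funpow_norm_contraction:
  fixes f :: "'a::real_normed_vector \<Rightarrow> 'a"
  assumes "0 \<le> k" "k \<le> 1"
    and contr: "\<And>z. norm z < \<delta> \<Longrightarrow> norm (f z) \<le> k * norm z"
    and "norm z < \<delta>"
  shows "norm ((f ^^ j) z) \<le> k ^ j * norm z"
proof (induction j)
  case (Suc j)
  have "k ^ j * norm z \<le> 1 * norm z"
    using assms by (intro mult_right_mono power_le_one) auto
  then have "norm ((f ^^ j) z) < \<delta>" using Suc assms by linarith
  then have "norm ((f ^^ Suc j) z) \<le> k * norm ((f ^^ j) z)" using contr by simp
  also have "\<dots> \<le> k * (k ^ j * norm z)" using Suc assms by (intro mult_left_mono) auto
  finally show ?case by (simp add: mult.assoc)
qed auto

text \<open>
  The norm is a strict Lyapunov function: small balls are forward invariant, and orbits in them decay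
  geometrically.
\<close>

lemma contraction_imp_local_attractor:
  fixes f :: "'a::real_normed_vector \<Rightarrow> 'a"
  assumes "0 < \<delta>" "0 \<le> k" "k < 1"
    and contr: "\<And>z. norm z < \<delta> \<Longrightarrow> norm (f z) \<le> k * norm z"
  shows "local_attractor euclidean f 0"
proof -
  have iter: "norm ((f ^^ j) z) \<le> k ^ j * norm z" if "norm z < \<delta>" for j z
    by (rule funpow_norm_contraction[of k \<delta>]) (use assms that in auto)
  have "f 0 = 0" using contr[of 0] \<open>0 < \<delta>\<close> by simp
  moreover have "lyapunov_stable euclidean f 0"
    unfolding lyapunov_stable_def
  proof (intro allI impI)
    fix U :: "'a set"
    assume "openin euclidean U \<and> 0 \<in> U"
    then obtain e where e: "e > 0" "ball 0 e \<subseteq> U"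
      by (auto simp: open_contains_ball)
    have "(f ^^ j) z \<in> U" if "norm z < min \<delta> e" for j z
    proof -
      have "k ^ j * norm z \<le> 1 * norm z"
        using assms by (intro mult_right_mono power_le_one) auto
      then have "norm ((f ^^ j) z) < e" using iter[of z j] that by auto
      then show ?thesis using e by (auto simp: dist_norm)
    qed
    then show "\<exists>V. openin euclidean V \<and> 0 \<in> V \<and> (\<forall>x\<in>V. \<forall>j. (f ^^ j) x \<in> U)"
      using e \<open>0 < \<delta>\<close> by (intro exI[of _ "ball 0 (min \<delta> e)"]) auto
  qed
  moreover have "locally_attracting euclidean f 0"
    unfolding locally_attracting_def
  proof (intro exI[of _ "ball 0 \<delta>"] conjI ballI)
    fix z :: 'a assume "z \<in> ball 0 \<delta>"
    then have z: "norm z < \<delta>" by simp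
    have "(\<lambda>j. k ^ j * norm z) \<longlonglongrightarrow> 0 * norm z"
      using assms by (intro tendsto_intros LIMSEQ_power_zero) auto
    then have "(\<lambda>j. k ^ j * norm z) \<longlonglongrightarrow> 0" by simp
    then have "(\<lambda>j. (f ^^ j) z) \<longlonglongrightarrow> 0"
      by (rule Lim_null_comparison[rotated]) (use iter[OF z] in \<open>simp add: always_eventually\<close>)
    then show "limitin euclidean (\<lambda>j. (f ^^ j) z) 0 sequentially" by simp
  qed (use \<open>0 < \<delta>\<close> in auto)
  ultimately show ?thesis by (simp add: local_attractor_def)
qed

text \<open>
  The complements of balls form a neighbourhood base at infinity, so orbits can be followed there
  by the size of their norms alone.
\<close>

lemma openin_Alexandroff_None_outside_ball:
  fixes U :: "'a::euclidean_space option set"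
  assumes "openin (Alexandroff_compactification euclidean) U" "None \<in> U"
  obtains r where "\<And>z. norm z > r \<Longrightarrow> Some z \<in> U"
proof -
  obtain C :: "'a set" where C: "compact C" and U: "U = insert None (Some ` (- C))"
    using assms by (auto simp: openin_Alexandroff_compactification Compl_eq_Diff_UNIV)
  obtain r where "\<And>x. x \<in> C \<Longrightarrow> norm x \<le> r"
    using compact_imp_bounded[OF C] by (auto simp: bounded_iff)
  then show ?thesis using that[of r] U by force
qed

lemma openin_Alexandroff_outside_ball:
  "openin (Alexandroff_compactification euclidean)
     (insert None (Some ` {z::'a::euclidean_space. norm z > r}))"
proof -
  have "{z::'a. norm z > r} = topspace euclidean - cball 0 r" by auto
  then show ?thesis unfolding openin_Alexandroff_compactification
    by (intro disjI2 exI[of _ "cball 0 r"]) auto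
qed

lemma funpow_map_option:
  fixes h :: "'a \<Rightarrow> 'a"
  shows "(map_option h ^^ j) x = map_option (h ^^ j) x"
  by (cases x; induction j) auto

text \<open>
  The counterpart at infinity of the contraction criterion: exteriors of large balls are
  forward invariant, and the norms along orbits in them grow geometrically.
\<close>

lemma expansion_imp_local_attractor_infinity:
  fixes h :: "'a::euclidean_space \<Rightarrow> 'a"
  assumes "0 < R" "1 < K"
    and expand: "\<And>w. norm w \<ge> R \<Longrightarrow> norm (h w) \<ge> K * norm w"
  shows "local_attractor (Alexandroff_compactification euclidean) (map_option h) None"
proof -
  let ?X = "Alexandroff_compactification (euclidean :: 'a topology)"
  have iter: "norm ((h ^^ j) w) \<ge> K ^ j * norm w" if "norm w \<ge> R" for j w
  proof (induction j)
    case (Suc j)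
    have "1 * norm w \<le> K ^ j * norm w"
      using assms by (intro mult_right_mono one_le_power) auto
    then have "norm ((h ^^ j) w) \<ge> R" using Suc that by linarith
    then have "norm ((h ^^ Suc j) w) \<ge> K * norm ((h ^^ j) w)" using expand by simp
    moreover have "K * norm ((h ^^ j) w) \<ge> K * (K ^ j * norm w)"
      using Suc assms by (intro mult_left_mono) auto
    ultimately show ?case by (simp add: mult.assoc)
  qed auto
  have pow: "filterlim (\<lambda>j. K ^ j) at_top sequentially"
    using \<open>1 < K\<close> filterlim_realpow_sequentially_gt1[of K]
    by (intro filterlim_at_infinity_imp_filterlim_at_top) auto
  have "lyapunov_stable ?X (map_option h) None"
    unfolding lyapunov_stable_def
  proof (intro allI impI)
    fix U assume "openin ?X U \<and> None \<in> U"
    then obtain r where r: "\<And>z. norm z > r \<Longrightarrow> Some z \<in> U" and "None \<in> U"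
      using openin_Alexandroff_None_outside_ball by metis
    have "Some ((h ^^ j) w) \<in> U" if "norm w > max R r" for j w
    proof -
      have "1 * norm w \<le> K ^ j * norm w"
        using assms by (intro mult_right_mono one_le_power) auto
      then have "norm ((h ^^ j) w) > r" using iter[of w j] that by auto
      then show ?thesis by (rule r)
    qed
    then show "\<exists>V. openin ?X V \<and> None \<in> V \<and> (\<forall>x\<in>V. \<forall>j. (map_option h ^^ j) x \<in> U)"
      using \<open>None \<in> U\<close> openin_Alexandroff_outside_ball[of "max R r"]
      by (intro exI[of _ "insert None (Some ` {z. norm z > max R r})"])
         (auto simp: funpow_map_option)
  qed
  moreover have "locally_attracting ?X (map_option h) None"
    unfolding locally_attracting_def
  proof (intro exI[of _ "insert None (Some ` {z. norm z > R})"] conjI ballI)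
    fix x assume x: "x \<in> insert None (Some ` {z::'a. norm z > R})"
    show "limitin ?X (\<lambda>j. (map_option h ^^ j) x) None sequentially"
      unfolding limitin_def
    proof (intro conjI allI impI)
      fix U assume "openin ?X U \<and> None \<in> U"
      then obtain r where r: "\<And>z. norm z > r \<Longrightarrow> Some z \<in> U" and "None \<in> U"
        using openin_Alexandroff_None_outside_ball by metis
      show "\<forall>\<^sub>F j in sequentially. (map_option h ^^ j) x \<in> U"
      proof (cases x)
        case None
        then show ?thesis using \<open>None \<in> U\<close> by (simp add: funpow_map_option)
      next
        case (Some w)
        then have w: "norm w > R" using x by auto
        have "filterlim (\<lambda>j. K ^ j * norm w) at_top sequentially"
          using w \<open>0 < R\<close>
          by (intro filterlim_at_top_mult_tendsto_pos[of _ "norm w"] tendsto_const pow)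
             auto
        then have "\<forall>\<^sub>F j in sequentially. K ^ j * norm w > r"
          by (simp add: filterlim_at_top_dense)
        then show ?thesis
        proof eventually_elim
          case (elim j)
          then have "norm ((h ^^ j) w) > r" using iter[of w j] w by linarith
          then show ?case using r Some by (simp add: funpow_map_option)
        qed
      qed
    qed auto
  qed (use openin_Alexandroff_outside_ball in auto)
  ultimately show ?thesis by (simp add: local_attractor_def)
qed

section \<open>The rotation and its powers\<close>

lemma rotation_eq: "rotation n z = rotation n 1 * z"
  by (simp add: rotation_def)

lemma norm_rotation_1 [simp]: "norm (rotation n 1) = 1"
  by (simp add: rotation_def norm_exp_eq_Re complex_is_Real_iff)

lemma rotation_1_nonzero [simp]: "rotation n 1 \<noteq> 0"
  by (simp add: rotation_def)

lemma norm_rotation [simp]: "norm (rotation n z) = norm z"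
  using rotation_eq[of n z] norm_rotation_1[of n] by (simp add: norm_mult del: norm_rotation_1)

lemma rotation_funpow: "(rotation n ^^ k) z = rotation n 1 ^ k * z"
  by (induction k) (auto simp: rotation_eq[of n "_ * _"])

lemma rotation_1_power_eq_1_iff:
  assumes "n \<ge> 1"
  shows "rotation n 1 ^ k = 1 \<longleftrightarrow> n dvd k"
proof -
  have "rotation n 1 ^ k = exp (2 * of_real pi * \<i> * of_nat k / of_nat n)"
    by (simp add: rotation_def exp_of_nat_mult [symmetric] mult_ac)
  then show ?thesis using complex_root_unity_eq_1[OF assms] by simp
qed

lemma root_of_unity_imp_rotation_power:
  assumes "n \<ge> 1" "c ^ n = 1"
  obtains k where "c = rotation n 1 ^ k"
proof -
  obtain k where "c = exp (2 * of_real pi * \<i> * of_nat k / of_nat n)"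
    using complex_roots_unity[OF assms(1)] assms(2) by blast
  then have "c = rotation n 1 ^ k"
    by (simp add: rotation_def exp_of_nat_mult [symmetric] mult_ac)
  then show ?thesis by (rule that)
qed

section \<open>The gain and its bounds\<close>

text \<open>
  This is the weight \<open>3 + cos (n \<phi>) + sin (2 n \<phi>)\<close> of the direction with angle \<open>\<phi>\<close>. The first harmonic
  makes its smallest period \<open>2 \<pi> / n\<close>; the second one is out of phase and removes all mirror symmetries.
\<close>

definition angular_weight :: "nat \<Rightarrow> complex \<Rightarrow> real" where
  "angular_weight n u = 3 + Re (u ^ n) + Im ((u ^ n)\<^sup>2)"

text \<open>
  The radial factor \<open>s / (1 + s)\<^sup>2\<close> with \<open>s = \<bar>z\<bar>\<^sup>2\<close> vanishes at the origin and at infinity, so the gain is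
  close to \<open>1/2\<close> at both ends. Its maximum \<open>1/4\<close>, attained on the unit circle, lifts the gain to exactly \<open>1\<close>
  in the directions of weight \<open>2\<close>. At the origin \<open>sgn\<close> is zero, but the radial factor hides the weight.
\<close>

definition gain :: "nat \<Rightarrow> complex \<Rightarrow> real" where
  "gain n z = 1/2 + angular_weight n (sgn z) * (norm z)\<^sup>2 / (1 + (norm z)\<^sup>2)\<^sup>2"

definition ray_map :: "nat \<Rightarrow> complex \<Rightarrow> complex" where
  "ray_map n z = rotation n (of_real (gain n z) * z)"

lemma one_add_square_pos [simp]: "1 + (x::real)\<^sup>2 > 0"
  by (simp add: add_pos_nonneg)

lemma one_add_square_nonzero [simp]: "1 + (x::real)\<^sup>2 \<noteq> 0"
  using one_add_square_pos[of x] by linarith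

lemma angular_weight_bounds:
  assumes "norm u \<le> 1"
  shows "1 \<le> angular_weight n u" "angular_weight n u \<le> 5"
proof -
  have "norm (u ^ n) \<le> 1"
    using assms by (simp add: norm_power power_le_one)
  moreover from this have "norm ((u ^ n)\<^sup>2) \<le> 1"
    unfolding norm_power by (simp add: power_le_one)
  ultimately have "\<bar>Re (u ^ n)\<bar> \<le> 1" "\<bar>Im ((u ^ n)\<^sup>2)\<bar> \<le> 1"
    using abs_Re_le_cmod[of "u ^ n"] abs_Im_le_cmod[of "(u ^ n)\<^sup>2"] by linarith+
  then show "1 \<le> angular_weight n u" "angular_weight n u \<le> 5"
    by (auto simp: angular_weight_def)
qed

lemma angular_weight_sgn_bounds:
  "1 \<le> angular_weight n (sgn z)" "angular_weight n (sgn z) \<le> 5"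
  by (intro angular_weight_bounds, simp add: norm_sgn)+

lemma gain_ge_half: "gain n z \<ge> 1/2"
  using angular_weight_sgn_bounds(1)[of n z] by (simp add: gain_def)

lemma gain_pos: "gain n z > 0"
  using gain_ge_half[of n z] by linarith

lemma gain_0 [simp]: "gain n 0 = 1/2"
  by (simp add: gain_def)

lemma gain_le_near_0: "gain n z \<le> 1/2 + 5 * (norm z)\<^sup>2"
proof -
  let ?s = "(norm z)\<^sup>2"
  have "angular_weight n (sgn z) * ?s \<le> 5 * ?s"
    by (intro mult_right_mono angular_weight_sgn_bounds) simp
  also have "\<dots> \<le> 5 * ?s * (1 + ?s)\<^sup>2"
    using mult_left_mono[of 1 "(1 + ?s)\<^sup>2" "5 * ?s"] by (simp add: one_le_power)
  finally have "angular_weight n (sgn z) * ?s / (1 + ?s)\<^sup>2 \<le> 5 * ?s"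
    by (subst pos_divide_le_eq) simp_all
  then show ?thesis by (simp add: gain_def)
qed

lemma gain_le_near_infinity:
  assumes "norm z \<ge> 5"
  shows "gain n z \<le> 3/4"
proof -
  let ?s = "(norm z)\<^sup>2"
  have s: "?s \<ge> 25" using assms power_mono[of 5 "norm z" 2] by simp
  have "angular_weight n (sgn z) * ?s \<le> 5 * ?s"
    by (intro mult_right_mono angular_weight_sgn_bounds) simp
  also have "\<dots> \<le> 1/4 * (1 + ?s)\<^sup>2"
    using s mult_right_mono[of 25 ?s ?s] by (simp add: power2_eq_square[of "1 + _"] algebra_simps)
  finally have "angular_weight n (sgn z) * ?s / (1 + ?s)\<^sup>2 \<le> 1/4"
    by (subst pos_divide_le_eq) simp_all
  then show ?thesis by (simp add: gain_def)
qed

section \<open>A differentiable bijection of the plane\<close>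

lemma norm_ray_map: "norm (ray_map n z) = gain n z * norm z"
  using gain_pos[of n z] by (simp add: ray_map_def) (simp add: norm_mult)

lemma ray_map_0 [simp]: "ray_map n 0 = 0"
  by (simp add: ray_map_def rotation_def)

lemma gain_rotation:
  assumes "n \<ge> 1"
  shows "gain n (rotation n z) = gain n z"
proof -
  have "sgn (rotation n z) = rotation n 1 * sgn z"
    unfolding rotation_eq[of n z] sgn_mult by (simp add: sgn_eq)
  then have "sgn (rotation n z) ^ n = sgn z ^ n"
    using rotation_1_power_eq_1_iff[OF assms, of n] by (simp add: power_mult_distrib)
  then show ?thesis by (simp add: gain_def angular_weight_def)
qed

lemma ray_map_rotation:
  assumes "n \<ge> 1"
  shows "ray_map n (rotation n z) = rotation n (ray_map n z)"
  by (simp add: ray_map_def gain_rotation[OF assms]) (simp add: rotation_def)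

text \<open>
  The effect of the map on distances to the origin along a ray of weight \<open>m\<close>.
\<close>

definition radial_profile :: "real \<Rightarrow> real \<Rightarrow> real" where
  "radial_profile m r = (1/2 + m * r\<^sup>2 / (1 + r\<^sup>2)\<^sup>2) * r"

text \<open>
  With \<open>s = r\<^sup>2\<close> the derivative is \<open>1/2 + m s (3 - s) / (1 + s)\<^sup>3\<close>. It can only be endangered by large
  weights at \<open>s > 3\<close>, so the sign is decided by the extreme weight \<open>5\<close>; over the denominator \<open>2 (1 + s)\<^sup>3\<close> the numerator is then
  \<open>(1 + s)\<^sup>3 - 10 s (s - 3) = s\<^sup>3 - 7 s\<^sup>2 + 33 s + 1\<close>, which is positive by completing the square.
\<close>

lemma radial_profile_less:
  assumes m: "0 < m" "m \<le> 5" and r: "a < b"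
  shows "radial_profile m a < radial_profile m b"
proof (rule DERIV_pos_imp_increasing[OF r])
  fix r :: real
  define s where "s = r\<^sup>2"
  have s: "s \<ge> 0" by (simp add: s_def)
  have "(1 + s) ^ 3 + 2 * m * (s * (3 - s)) > 0"
  proof (cases "s \<le> 3")
    case True
    then show ?thesis using m s by (intro add_pos_nonneg) auto
  next
    case False
    have "m * (s * (s - 3)) \<le> 5 * (s * (s - 3))"
      using False m by (intro mult_right_mono) auto
    moreover have "(1 + s) ^ 3 - 10 * (s * (s - 3)) = s * ((s - 7/2)\<^sup>2 + 83/4) + 1"
      by (simp add: power2_eq_square power3_eq_cube algebra_simps)
    moreover have "s * ((s - 7/2)\<^sup>2 + 83/4) \<ge> 0"
      using s by simp
    ultimately show ?thesis by (simp add: algebra_simps)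
  qed
  then have D_pos: "((1 + s) ^ 3 + 2 * m * (s * (3 - s))) / (2 * (1 + s) ^ 3) > 0"
    using s by (intro divide_pos_pos) auto
  have D: "1/2 + m * s / (1 + s)\<^sup>2 + (2 * m * s * (1 + s)\<^sup>2 - 4 * m * s\<^sup>2 * (1 + s)) / ((1 + s)\<^sup>2)\<^sup>2
      = ((1 + s) ^ 3 + 2 * m * (s * (3 - s))) / (2 * (1 + s) ^ 3)"
  proof -
    define q where "q = 1 + s"
    have "q \<noteq> 0" and s_eq: "s = q - 1" using s by (auto simp: q_def)
    have "(2 * m * s * q\<^sup>2 - 4 * m * s\<^sup>2 * q) / (q\<^sup>2)\<^sup>2 = (2 * m * s * q - 4 * m * s\<^sup>2) / q ^ 3"
      using \<open>q \<noteq> 0\<close> by (simp add: divide_simps) (simp add: algebra_simps eval_nat_numeral)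
    moreover have "m * s / q\<^sup>2 = m * s * q / q ^ 3"
      using \<open>q \<noteq> 0\<close> by (simp add: eval_nat_numeral)
    moreover have "m * s * q + (2 * m * s * q - 4 * m * s\<^sup>2) = m * (s * (3 - s))"
      by (simp add: s_eq power2_eq_square algebra_simps)
    ultimately have "m * s / q\<^sup>2 + (2 * m * s * q\<^sup>2 - 4 * m * s\<^sup>2 * q) / (q\<^sup>2)\<^sup>2 = m * (s * (3 - s)) / q ^ 3"
      by (metis add_divide_distrib)
    moreover have "(q ^ 3 + 2 * m * (s * (3 - s))) / (2 * q ^ 3) = 1/2 + m * (s * (3 - s)) / q ^ 3"
      using \<open>q \<noteq> 0\<close> by (simp add: add_divide_distrib)
    ultimately show ?thesis unfolding q_def[symmetric] by linarith
  qed
  have "(radial_profile m has_real_derivative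
      (1/2 + m * r\<^sup>2 / (1 + r\<^sup>2)\<^sup>2)
      + ((2 * m * r) * (1 + r\<^sup>2)\<^sup>2 - m * r\<^sup>2 * (2 * (1 + r\<^sup>2) * (2 * r))) / ((1 + r\<^sup>2)\<^sup>2 * (1 + r\<^sup>2)\<^sup>2) * r) (at r)"
    unfolding radial_profile_def
    by (auto intro!: derivative_eq_intros)
  also have "(1/2 + m * r\<^sup>2 / (1 + r\<^sup>2)\<^sup>2)
      + ((2 * m * r) * (1 + r\<^sup>2)\<^sup>2 - m * r\<^sup>2 * (2 * (1 + r\<^sup>2) * (2 * r))) / ((1 + r\<^sup>2)\<^sup>2 * (1 + r\<^sup>2)\<^sup>2) * r
    = 1/2 + m * s / (1 + s)\<^sup>2 + (2 * m * s * (1 + s)\<^sup>2 - 4 * m * s\<^sup>2 * (1 + s)) / ((1 + s)\<^sup>2)\<^sup>2"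
  proof -
    have "((2 * m * r) * (1 + r\<^sup>2)\<^sup>2 - m * r\<^sup>2 * (2 * (1 + r\<^sup>2) * (2 * r))) * r
        = 2 * m * s * (1 + s)\<^sup>2 - 4 * m * s\<^sup>2 * (1 + s)"
      unfolding s_def by (simp add: power2_eq_square algebra_simps)
    then show ?thesis
      unfolding times_divide_eq_left power2_eq_square[of "(1 + s)\<^sup>2"] by (simp add: s_def)
  qed
  finally have "(radial_profile m has_real_derivative
      ((1 + s) ^ 3 + 2 * m * (s * (3 - s))) / (2 * (1 + s) ^ 3)) (at r)"
    unfolding D .
  with D_pos show "\<exists>y. (radial_profile m has_real_derivative y) (at r) \<and> y > 0" by blast
qed

lemma gain_on_ray:
  assumes "norm u = 1" "r > 0"
  shows "gain n (of_real r * u) * r = radial_profile (angular_weight n u) r"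
proof -
  have "sgn (of_real r * u) = u"
    using assms by (simp add: sgn_div_norm norm_mult scaleR_conv_of_real)
  then show ?thesis using assms by (simp add: gain_def radial_profile_def norm_mult)
qed

lemma norm_mult_sgn: "of_real (norm z) * sgn z = (z::complex)"
  by (cases "z = 0") (simp_all add: sgn_eq)

text \<open>
  Rays go to rays, and different rays to different ones, because the gain is positive; on each ray
  the map is the strictly increasing radial profile.
\<close>

lemma inj_ray_map: "inj (ray_map n)"
proof (rule injI)
  fix x y :: complex
  assume eq: "ray_map n x = ray_map n y"
  show "x = y"
  proof (cases "x = 0 \<or> y = 0")
    case True
    then show ?thesis
      using eq norm_ray_map[of n x] norm_ray_map[of n y] gain_pos[of n x] gain_pos[of n y] by auto
  next
    case False
    have eq': "of_real (gain n x) * x = of_real (gain n y) * y"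
      using eq by (simp add: ray_map_def rotation_def)
    have "sgn (of_real (gain n z) * z) = sgn z" for z
      using gain_pos[of n z] by (simp add: sgn_mult sgn_of_real)
    then have sgn: "sgn x = sgn y" using eq' by metis
    have polar: "gain n z * norm z = radial_profile (angular_weight n (sgn z)) (norm z)" for z
      by (simp add: gain_def radial_profile_def)
    have "radial_profile (angular_weight n (sgn x)) (norm x)
        = radial_profile (angular_weight n (sgn x)) (norm y)"
      using eq polar sgn by (metis norm_ray_map)
    then have "norm x = norm y"
      using radial_profile_less angular_weight_sgn_bounds[of n x]
      by (metis less_irrefl linorder_neqE_linordered_idom zero_less_one order_less_le_trans)
    with sgn show ?thesis
      by (metis norm_mult_sgn)
  qed
qed

text \<open>
  Since the weight is bounded, its discontinuity at the origin is damped by the radial factor.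
\<close>

lemma gain_tendsto_0: "gain n \<midarrow>0\<rightarrow> 1/2"
proof -
  have "(\<lambda>h. 1/2 + 5 * (norm h)\<^sup>2) \<midarrow>0::complex\<rightarrow> 1/2 + 5 * (norm (0::complex))\<^sup>2"
    by (intro tendsto_intros)
  then show "gain n \<midarrow>0\<rightarrow> 1/2"
    by (intro tendsto_sandwich[OF always_eventually always_eventually tendsto_const, of "1/2" "gain n"])
       (use gain_ge_half[of n] in \<open>simp_all add: gain_le_near_0\<close>)
qed

text \<open>
  Away from the origin the map is built from smooth functions. At the origin the continuity of the
  gain is enough: the difference quotient is the gain times a constant rotation.
\<close>

lemma ray_map_differentiable: "ray_map n differentiable (at z)"
proof (cases "z = 0")
  case True
  have "(\<lambda>h. rotation n 1 * of_real (gain n h)) \<midarrow>0\<rightarrow> rotation n 1 * of_real (1/2)"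
    by (intro tendsto_intros gain_tendsto_0)
  then have "(\<lambda>h. (ray_map n (0 + h) - ray_map n 0) / h) \<midarrow>0\<rightarrow> rotation n 1 * of_real (1/2)"
    by (rule Lim_transform_eventually)
       (auto simp: eventually_at ray_map_def rotation_def intro!: exI[of _ 1])
  then have "(ray_map n has_field_derivative (rotation n 1 * of_real (1/2))) (at 0)"
    by (simp add: DERIV_def)
  then show ?thesis
    using True has_field_derivative_imp_has_derivative differentiableI by blast
next
  case False
  have compose: "(\<lambda>x. L (h x)) differentiable (at z)"
    if "bounded_linear L" "h differentiable (at z)" for L :: "'b::real_normed_vector \<Rightarrow> 'c::real_normed_vector" and h
    using that bounded_linear.has_derivative unfolding differentiable_def by blast
  have norm: "(\<lambda>x::complex. norm x) differentiable (at z)" using False by simp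
  have sgn: "(\<lambda>x. x / of_real (norm x)) differentiable (at z)"
    using False by (intro differentiable_divide differentiable_ident compose[OF bounded_linear_of_real] norm) auto
  have "(\<lambda>x. 1/2 + (3 + Re ((x / of_real (norm x)) ^ n) + Im (((x / of_real (norm x)) ^ n)\<^sup>2))
          * (norm x)\<^sup>2 / (1 + (norm x)\<^sup>2)\<^sup>2) differentiable (at z)"
    by (intro differentiable_add differentiable_mult differentiable_divide differentiable_power
          differentiable_const compose[OF bounded_linear_Re] compose[OF bounded_linear_Im] sgn norm)
       simp_all
  then have "gain n differentiable (at z)"
    unfolding gain_def[abs_def] angular_weight_def sgn_eq .
  then show ?thesis
    unfolding ray_map_def[abs_def] rotation_def
    by (intro differentiable_mult differentiable_const differentiable_ident compose[OF bounded_linear_of_real])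
qed

lemma continuous_on_ray_map: "continuous_on S (ray_map n)"
  by (meson ray_map_differentiable continuous_at_imp_continuous_on differentiable_imp_continuous_within)

text \<open>
  A given point \<open>w\<close> is reached on the ray whose rotated image contains \<open>w\<close>: the radial profile starts
  at \<open>0\<close> and, as the gain is at least \<open>1/2\<close>, is at least \<open>\<bar>w\<bar>\<close> at distance \<open>2 \<bar>w\<bar>\<close>.
\<close>

lemma surj_ray_map: "surj (ray_map n)"
  unfolding surj_def
proof
  fix w :: complex
  show "\<exists>z. w = ray_map n z"
  proof (cases "w = 0")
    case False
    define u where "u = sgn w / rotation n 1"
    define m where "m = angular_weight n u"
    have u: "norm u = 1" using False by (simp add: u_def norm_divide norm_sgn)
    have "m > 0" using angular_weight_bounds(1)[of u n] u by (simp add: m_def)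
    then have "norm w \<le> radial_profile m (2 * norm w)"
      by (simp add: radial_profile_def algebra_simps)
    moreover have "continuous_on {0..2 * norm w} (radial_profile m)"
      unfolding radial_profile_def
      by (intro continuous_intros) simp_all
    ultimately obtain r where r: "0 \<le> r" "radial_profile m r = norm w"
      using IVT'[of "radial_profile m" 0 "norm w" "2 * norm w"] by (auto simp: radial_profile_def)
    with False have "r > 0" by (cases "r = 0") (auto simp: radial_profile_def)
    have "ray_map n (of_real r * u)
        = of_real (gain n (of_real r * u) * r) * (rotation n 1 * u)"
      by (simp add: ray_map_def rotation_def)
    also have "\<dots> = of_real (norm w) * sgn w"
      using gain_on_ray[OF u \<open>r > 0\<close>, of n] r by (simp add: u_def m_def)
    also have "\<dots> = w"
      by (rule norm_mult_sgn)
    finally show ?thesis by metis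
  qed (auto intro: exI[of _ 0])
qed

text \<open>
  Continuity of the inverse comes for free, by invariance of domain.
\<close>

lemma ray_map_differentiable_homeomorphism: "differentiable_homeomorphism (ray_map n)"
proof -
  obtain g where "homeomorphism UNIV (range (ray_map n)) (ray_map n) g"
    by (rule invariance_of_domain_homeomorphism[of UNIV "ray_map n"])
       (auto simp: continuous_on_ray_map inj_ray_map)
  then show ?thesis
    unfolding differentiable_homeomorphism_def surj_ray_map by (auto simp: ray_map_differentiable)
qed

section \<open>The linear symmetries\<close>

lemma ray_map_scaleR: "ray_map n (t *\<^sub>R z) = (t * gain n (t *\<^sub>R z)) *\<^sub>R rotation n z"
  by (simp add: ray_map_def rotation_def scaleR_conv_of_real)

text \<open>
  The idea is to blow up at the origin. Comparing both sides of the commutation relation along the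
  ray through \<open>z\<close> shows that the rotated image of \<open>z\<close> under \<open>\<gamma>\<close> and the image of the rotated \<open>z\<close> are
  proportional, with the ratio of the two gains as factor. This factor is the same at every
  distance, and near the origin both gains tend to \<open>1/2\<close>; so it is \<open>1\<close>.
\<close>

lemma commuting_linear_preserves_gain:
  assumes \<gamma>: "linear \<gamma>" "inj \<gamma>" and comm: "\<And>x. ray_map n (\<gamma> x) = \<gamma> (ray_map n x)"
  shows "gain n (\<gamma> z) = gain n z"
proof (cases "z = 0")
  case True
  then show ?thesis using \<gamma> by (simp add: linear_0)
next
  case False
  then have "\<gamma> z \<noteq> 0" using \<gamma> by (metis injD linear_0)
  have along_ray: "gain n (t *\<^sub>R \<gamma> z) *\<^sub>R rotation n (\<gamma> z) = gain n (t *\<^sub>R z) *\<^sub>R \<gamma> (rotation n z)"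
    if "t > 0" for t
  proof -
    have "t *\<^sub>R (gain n (t *\<^sub>R \<gamma> z) *\<^sub>R rotation n (\<gamma> z))
        = t *\<^sub>R (gain n (t *\<^sub>R z) *\<^sub>R \<gamma> (rotation n z))"
      using comm[of "t *\<^sub>R z"] \<gamma> by (simp add: ray_map_scaleR linear_scale)
    then show ?thesis using that by (simp only: scaleR_cancel_left) simp
  qed
  have lim: "((\<lambda>t. gain n (t *\<^sub>R x) *\<^sub>R y) \<longlongrightarrow> (1/2) *\<^sub>R y) (at_right 0)" for x y :: complex
  proof -
    have "isCont (gain n) 0" using gain_tendsto_0[of n] by (simp add: isCont_def)
    moreover have "((\<lambda>t. t *\<^sub>R x) \<longlongrightarrow> 0 *\<^sub>R x) (at_right 0)"
      by (intro tendsto_intros)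
    ultimately have "((\<lambda>t. gain n (t *\<^sub>R x)) \<longlongrightarrow> gain n 0) (at_right 0)"
      by (intro isCont_tendsto_compose[of _ "gain n"]) simp_all
    from tendsto_scaleR[OF this tendsto_const[of y]] show ?thesis by simp
  qed
  have "((\<lambda>t. gain n (t *\<^sub>R \<gamma> z) *\<^sub>R rotation n (\<gamma> z)) \<longlongrightarrow> (1/2) *\<^sub>R \<gamma> (rotation n z)) (at_right 0)"
    by (rule Lim_transform_eventually[OF lim[of z "\<gamma> (rotation n z)"]])
       (auto simp: eventually_at_right_field along_ray intro: exI[of _ 1])
  from tendsto_unique[OF _ lim this] have "rotation n (\<gamma> z) = \<gamma> (rotation n z)" by simp
  moreover have "rotation n (\<gamma> z) \<noteq> 0" using \<open>\<gamma> z \<noteq> 0\<close> by (metis norm_eq_zero norm_rotation)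
  ultimately show ?thesis using along_ray[of 1] by simp
qed

text \<open>
  The radial factor is no power of the distance, so scaling a ray cannot be compensated by another
  weight. Comparing the gains at two distances already separates the scale from the weight: the
  weights cancel from the quotient of the two equations.
\<close>

lemma gain_along_ray_determines:
  assumes "z \<noteq> 0" "w \<noteq> 0" and eq: "\<And>t. t > 0 \<Longrightarrow> gain n (t *\<^sub>R z) = gain n (t *\<^sub>R w)"
  shows "norm z = norm w" "angular_weight n (sgn z) = angular_weight n (sgn w)"
proof -
  define a b where "a = (norm z)\<^sup>2" and "b = (norm w)\<^sup>2"
  define m m' where "m = angular_weight n (sgn z)" and "m' = angular_weight n (sgn w)"
  have pos: "a > 0" "b > 0" "m > 0" "m' > 0"
    using assms angular_weight_sgn_bounds(1)[of n z] angular_weight_sgn_bounds(1)[of n w]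
    by (auto simp: a_def b_def m_def m'_def)
  have gain: "gain n (t *\<^sub>R x) = 1/2 + angular_weight n (sgn x) * (t\<^sup>2 * (norm x)\<^sup>2) / (1 + t\<^sup>2 * (norm x)\<^sup>2)\<^sup>2"
    if "t > 0" for t and x :: complex
    using that by (simp add: gain_def sgn_scaleR power_mult_distrib)
  have cross: "m * a * (1 + t\<^sup>2 * b)\<^sup>2 = m' * b * (1 + t\<^sup>2 * a)\<^sup>2" if "t > 0" for t
  proof -
    have "1 + t\<^sup>2 * a \<noteq> 0" "1 + t\<^sup>2 * b \<noteq> 0"
      using pos by (simp_all add: add_pos_nonneg order_less_imp_not_eq2)
    moreover have "m * (t\<^sup>2 * a) / (1 + t\<^sup>2 * a)\<^sup>2 = m' * (t\<^sup>2 * b) / (1 + t\<^sup>2 * b)\<^sup>2"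
      using eq[OF that] gain[OF that] by (simp add: a_def b_def m_def m'_def)
    ultimately have "t\<^sup>2 * (m * a * (1 + t\<^sup>2 * b)\<^sup>2) = t\<^sup>2 * (m' * b * (1 + t\<^sup>2 * a)\<^sup>2)"
      by (simp add: frac_eq_eq) (simp add: mult_ac)
    then show ?thesis using that by simp
  qed
  have "(m * a * (1 + b)\<^sup>2) * (m' * b * (1 + 4 * a)\<^sup>2) = (m' * b * (1 + a)\<^sup>2) * (m * a * (1 + 4 * b)\<^sup>2)"
    using cross[of 1] cross[of 2] by simp
  then have "(m * a * m' * b) * ((1 + b) * (1 + 4 * a))\<^sup>2 = (m * a * m' * b) * ((1 + a) * (1 + 4 * b))\<^sup>2"
    by (simp add: power_mult_distrib mult_ac)
  then have "((1 + b) * (1 + 4 * a))\<^sup>2 = ((1 + a) * (1 + 4 * b))\<^sup>2"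
    using pos by simp
  then have "(1 + b) * (1 + 4 * a) = (1 + a) * (1 + 4 * b)"
    using pos by (subst (asm) power2_eq_iff_nonneg) auto
  then have "a = b" by (simp add: algebra_simps)
  then show "norm z = norm w" by (simp add: a_def b_def)
  have "1 + a \<noteq> 0" using pos by linarith
  then show "angular_weight n (sgn z) = angular_weight n (sgn w)"
    using cross[of 1] \<open>a = b\<close> pos by (simp add: m_def m'_def)
qed

text \<open>
  Up to the unit factor \<open>\<gamma> 1\<close> only the image \<open>e\<close> of \<open>\<i>\<close> is free. It has norm \<open>1\<close>, and the length of
  the image of \<open>1 + \<i>\<close> makes it orthogonal to \<open>1\<close>.
\<close>

lemma complex_linear_isometry_cases:
  assumes \<gamma>: "linear \<gamma>" and iso: "\<And>z. norm (\<gamma> z) = norm (z :: complex)"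
  obtains c where "norm c = 1" "\<gamma> = (\<lambda>z. c * z)"
    | c where "norm c = 1" "\<gamma> = (\<lambda>z. c * cnj z)"
proof -
  define c e where "c = \<gamma> 1" and "e = \<gamma> \<i> / \<gamma> 1"
  have c: "norm c = 1" using iso[of 1] by (simp add: c_def)
  then have "c \<noteq> 0" by auto
  then have \<gamma>i: "\<gamma> \<i> = c * e" by (simp add: c_def e_def)
  have \<gamma>_eq: "\<gamma> z = c * (of_real (Re z) + of_real (Im z) * e)" for z
  proof -
    have "\<gamma> z = \<gamma> (Re z *\<^sub>R 1 + Im z *\<^sub>R \<i>)"
      by (rule arg_cong[of _ _ \<gamma>]) (simp add: complex_eq_iff)
    also have "\<dots> = Re z *\<^sub>R \<gamma> 1 + Im z *\<^sub>R \<gamma> \<i>"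
      using \<gamma> by (simp only: linear_add linear_scale)
    also have "\<dots> = c * (of_real (Re z) + of_real (Im z) * e)"
      unfolding \<gamma>i c_def[symmetric] by (simp add: scaleR_conv_of_real algebra_simps)
    finally show ?thesis .
  qed
  have "norm e = 1" using iso[of \<i>] c by (simp add: \<gamma>i norm_mult)
  then have e1: "(Re e)\<^sup>2 + (Im e)\<^sup>2 = 1" by (metis cmod_power2 one_power2)
  have "norm (1 + e) = norm (1 + \<i>)"
    using iso[of "1 + \<i>"] c by (simp add: \<gamma>_eq norm_mult)
  then have "(norm (1 + e))\<^sup>2 = (norm (1 + \<i>))\<^sup>2" by simp
  then have "(1 + Re e)\<^sup>2 + (Im e)\<^sup>2 = 2" by (simp add: cmod_power2)
  with e1 have "Re e = 0" by (simp add: power2_eq_square algebra_simps)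
  with e1 have "(Im e)\<^sup>2 = 1" by simp
  then have "e = \<i> \<or> e = - \<i>"
    using \<open>Re e = 0\<close> by (auto simp: complex_eq_iff power2_eq_1_iff)
  then show ?thesis
  proof
    assume "e = \<i>"
    then have "\<gamma> = (\<lambda>z. c * z)"
      by (intro ext) (simp only: \<gamma>_eq, simp add: complex_eq_iff)
    with c show ?thesis by (rule that(1))
  next
    assume "e = - \<i>"
    then have "\<gamma> = (\<lambda>z. c * cnj z)"
      by (intro ext) (simp only: \<gamma>_eq, simp add: complex_eq_iff)
    with c show ?thesis by (rule that(2))
  qed
qed

lemma unit_complex_root:
  fixes w :: complex
  assumes "n \<ge> 1" "norm w = 1"
  obtains z where "norm z = 1" "z ^ n = w"
proof -
  obtain z where z: "w = z ^ n" using exists_complex_root[of n w] assms by auto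
  then have "norm z ^ n = 1" using assms by (simp add: norm_power)
  then have "norm z = 1" using assms power_eq_iff_eq_base[of n "norm z" 1] by simp
  with z show ?thesis by (intro that) auto
qed

lemma unit_complex_eq_1:
  assumes "norm c = 1" "Re c = 1"
  shows "c = 1"
proof -
  have "(Re c)\<^sup>2 + (Im c)\<^sup>2 = 1" using assms(1) by (metis cmod_power2 one_power2)
  with assms(2) show ?thesis by (simp add: complex_eq_iff)
qed

lemma symmetry_group_comp:
  assumes "\<alpha> \<in> symmetry_group f" "\<beta> \<in> symmetry_group f"
  shows "\<alpha> \<circ> \<beta> \<in> symmetry_group f"
  using assms by (auto simp: symmetry_group_def linear_compose bij_comp)

lemma symmetry_group_funpow:
  assumes "\<gamma> \<in> symmetry_group f"
  shows "\<gamma> ^^ k \<in> symmetry_group f"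
proof (induction k)
  case 0
  have "linear (\<lambda>x::complex. x)" "bij (\<lambda>x::complex. x)"
    using linear_id bij_id by (simp_all only: id_def)
  then show ?case by (simp add: symmetry_group_def id_def)
next
  case (Suc k)
  then show ?case using symmetry_group_comp[OF assms Suc.IH] by (simp only: funpow.simps)
qed

lemma rotation_group_subset_symmetry_group:
  assumes "n \<ge> 1"
  shows "rotation_group n \<subseteq> symmetry_group (ray_map n)"
proof -
  have lin: "linear (rotation n)"
    unfolding rotation_def[abs_def] by (intro bounded_linear.linear bounded_linear_mult_right)
  have inv_eq: "inv (rotation n) = (\<lambda>z. z / rotation n 1)"
    by (rule inv_unique_comp) (auto simp: fun_eq_iff rotation_def)
  have bij: "bij (rotation n)"
    by (rule o_bij[of "\<lambda>z. z / rotation n 1"]) (auto simp: fun_eq_iff rotation_def)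
  have "rotation n \<in> symmetry_group (ray_map n)"
    using lin bij ray_map_rotation[OF assms] by (simp add: symmetry_group_def)
  moreover have "inv (rotation n) \<in> symmetry_group (ray_map n)"
  proof -
    have "linear (inv (rotation n))"
      unfolding inv_eq by (intro bounded_linear.linear bounded_linear_divide)
    moreover have "ray_map n (inv (rotation n) x) = inv (rotation n) (ray_map n x)" for x
      using ray_map_rotation[OF assms, of "inv (rotation n) x"] bij
      by (metis bij_inv_eq_iff)
    ultimately show ?thesis using bij by (simp add: symmetry_group_def bij_imp_bij_inv)
  qed
  ultimately show ?thesis by (auto simp: rotation_group_def symmetry_group_funpow)
qed

text \<open>
  A symmetry preserves the gain, hence norms and weights, so it is a rotation or a reflection of the
  unit circle that preserves the weight. In terms of \<open>w = u\<^sup>n\<close> it multiplies \<open>w\<close> or its conjugate by a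
  unit number \<open>C\<close>. The values of the weight at \<open>w = 1\<close> and \<open>w = -1\<close> force \<open>Re C = 1\<close>, that is \<open>C = 1\<close>:
  rotations are then powers of the given one, and reflections are excluded by the second harmonic.
\<close>

lemma symmetry_group_subset_rotation_group:
  assumes n: "n \<ge> 1"
  shows "symmetry_group (ray_map n) \<subseteq> rotation_group n"
proof
  fix \<gamma> assume "\<gamma> \<in> symmetry_group (ray_map n)"
  then have \<gamma>: "linear \<gamma>" "inj \<gamma>" and comm: "\<And>x. ray_map n (\<gamma> x) = \<gamma> (ray_map n x)"
    by (auto simp: symmetry_group_def bij_is_inj)
  have "gain n (t *\<^sub>R \<gamma> z) = gain n (t *\<^sub>R z)" for t z
    using commuting_linear_preserves_gain[OF \<gamma> comm, of "t *\<^sub>R z"] \<gamma>(1) by (simp add: linear_scale)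
  moreover have "\<gamma> z \<noteq> 0" if "z \<noteq> 0" for z
    using \<gamma> that by (metis injD linear_0)
  ultimately have norm_\<gamma>: "norm (\<gamma> z) = norm z"
    and weight_\<gamma>: "angular_weight n (sgn (\<gamma> z)) = angular_weight n (sgn z)" if "z \<noteq> 0" for z
    using gain_along_ray_determines[of "\<gamma> z" z n] that by auto
  have iso: "norm (\<gamma> z) = norm z" for z
    using norm_\<gamma>[of z] \<gamma>(1) by (cases "z = 0") (auto simp: linear_0)
  have weight_unit: "angular_weight n (\<gamma> z) = angular_weight n z" if "norm z = 1" for z
  proof -
    have "sgn z = z" "sgn (\<gamma> z) = \<gamma> z" using that iso[of z] by (simp_all add: sgn_div_norm)
    moreover have "z \<noteq> 0" using that by auto
    ultimately show ?thesis using weight_\<gamma>[of z] by simp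
  qed
  from \<gamma>(1) iso show "\<gamma> \<in> rotation_group n"
  proof (cases rule: complex_linear_isometry_cases)
    case (1 c)
    have rot: "Re (c ^ n * w) + Im ((c ^ n * w)\<^sup>2) = Re w + Im (w\<^sup>2)" if w: "norm w = 1" for w
    proof -
      obtain z where z: "norm z = 1" "z ^ n = w" using unit_complex_root[OF n w] .
      then show ?thesis
        using weight_unit[OF z(1)] 1 by (simp add: angular_weight_def power_mult_distrib[of c z n])
    qed
    have "c ^ n = 1"
      using rot[of 1] rot[of "-1"] 1 by (intro unit_complex_eq_1) (simp_all add: norm_power)
    then obtain k where "c = rotation n 1 ^ k"
      using root_of_unity_imp_rotation_power[OF n] by blast
    then have "\<gamma> = rotation n ^^ k" using 1 by (simp add: fun_eq_iff rotation_funpow)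
    then show ?thesis by (auto simp: rotation_group_def)
  next
    case (2 c)
    have refl: "Re (c ^ n * cnj w) + Im ((c ^ n * cnj w)\<^sup>2) = Re w + Im (w\<^sup>2)" if w: "norm w = 1" for w
    proof -
      obtain z where z: "norm z = 1" "z ^ n = w" using unit_complex_root[OF n w] .
      then show ?thesis
        using weight_unit[OF z(1)] 2 by (simp add: angular_weight_def power_mult_distrib[of c _ n] flip: complex_cnj_power)
    qed
    have "c ^ n = 1"
      using refl[of 1] refl[of "-1"] 2 by (intro unit_complex_eq_1) (simp_all add: norm_power)
    \<comment> \<open>At an eighth root of unity the second harmonic changes sign under conjugation.\<close>
    obtain w :: complex where "norm w = 1" "w\<^sup>2 = \<i>"
      using unit_complex_root[of 2 \<i>] by auto
    then have False using refl[of w] \<open>c ^ n = 1\<close> by (simp flip: complex_cnj_power)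
    then show ?thesis ..
  qed
qed

section \<open>Dynamics of the map\<close>

lemma Fix_ray_map:
  assumes "n \<ge> 2"
  shows "Fix (ray_map n) = {0}"
proof -
  have "z = 0" if fixed: "ray_map n z = z" for z
  proof (rule ccontr)
    assume "z \<noteq> 0"
    then have "gain n z = 1" using norm_ray_map[of n z] fixed by simp
    then have "rotation n 1 * z = z" using fixed by (simp add: ray_map_def rotation_def)
    then have "rotation n 1 ^ 1 = 1" using \<open>z \<noteq> 0\<close> by simp
    then have "n dvd 1" using rotation_1_power_eq_1_iff[of n 1] assms by simp
    then show False using assms by simp
  qed
  then show ?thesis by (auto simp: Fix_def)
qed

text \<open>
  A unit vector \<open>p\<close> with \<open>p\<^sup>n = -1\<close> has weight \<open>3 - 1 + 0 = 2\<close>, hence gain \<open>1\<close>. On its orbit the map is the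
  rotation itself.
\<close>

lemma minimal_period_ray_map:
  assumes "n \<ge> 1"
  obtains p where "minimal_period (ray_map n) p n"
proof -
  obtain p :: complex where p: "norm p = 1" "p ^ n = -1"
    using unit_complex_root[OF assms, of "-1"] by auto
  have "gain n p = 1"
    using p by (simp add: gain_def angular_weight_def sgn_div_norm)
  then have gain: "gain n ((rotation n ^^ k) p) = 1" for k
    by (induction k) (simp_all add: gain_rotation[OF assms])
  have iter: "(ray_map n ^^ k) p = (rotation n ^^ k) p" for k
    by (induction k) (simp_all add: ray_map_def gain)
  have "p \<noteq> 0" using p by auto
  then have "(ray_map n ^^ k) p = p \<longleftrightarrow> n dvd k" for k
    using rotation_1_power_eq_1_iff[OF assms, of k] by (simp add: iter rotation_funpow)
  then have "minimal_period (ray_map n) p n"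
    using assms by (auto simp: minimal_period_def dest: dvd_imp_le)
  then show ?thesis by (rule that)
qed

lemma ray_map_local_attractor: "local_attractor euclidean (ray_map n) 0"
proof (rule contraction_imp_local_attractor[of "1/5" "3/4"])
  fix z :: complex assume "norm z < 1/5"
  then have "(norm z)\<^sup>2 \<le> (1/5)\<^sup>2" by (intro power_mono) auto
  then have "gain n z \<le> 3/4" using gain_le_near_0[of n z] by (simp add: power2_eq_square)
  then show "norm (ray_map n z) \<le> 3/4 * norm z"
    unfolding norm_ray_map by (intro mult_right_mono) auto
qed auto

text \<open>
  Points of norm at least \<open>5\<close> are contracted by \<open>3/4\<close>, so the inverse map expands the images of such
  points. The constant \<open>628\<close> only ensures that the preimage has norm at least \<open>5\<close>: a point of smaller
  norm has gain at most \<open>1/2 + 5 * 25\<close>, so its image has norm at most \<open>627.5\<close>.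
\<close>

lemma ray_map_infinity_repellor: "infinity_repellor (ray_map n)"
  unfolding infinity_repellor_def
proof (rule expansion_imp_local_attractor_infinity[of 628 "4/3"])
  fix w :: complex assume w: "norm w \<ge> 628"
  define z where "z = inv (ray_map n) w"
  have "ray_map n z = w" by (simp add: z_def surj_f_inv_f[OF surj_ray_map])
  then have norm_w: "norm w = gain n z * norm z" by (metis norm_ray_map)
  have "norm z \<ge> 5"
  proof (rule ccontr)
    assume "\<not> norm z \<ge> 5"
    then have z: "norm z \<le> 5" by simp
    then have "(norm z)\<^sup>2 \<le> 5\<^sup>2" by (intro power_mono) auto
    then have "gain n z \<le> 251/2" using gain_le_near_0[of n z] by simp
    then have "norm w \<le> 251/2 * 5" unfolding norm_w using z by (intro mult_mono) auto
    then show False using w by simp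
  qed
  then have "norm w \<le> 3/4 * norm z"
    unfolding norm_w by (intro mult_right_mono gain_le_near_infinity) auto
  then show "4/3 * norm w \<le> norm (inv (ray_map n) w)" by (simp add: z_def)
qed auto

theorem corollary3p3:
  fixes n :: nat
  assumes "n \<ge> 2"
  shows "\<exists>f :: complex \<Rightarrow> complex.
           differentiable_homeomorphism f \<and>
           symmetry_group f = rotation_group n \<and>
           Fix f = {0} \<and>
           local_attractor euclidean f 0 \<and>
           (\<exists>p. minimal_period f p n) \<and>
           infinity_repellor f"
proof (intro exI[of _ "ray_map n"] conjI)
  have n: "n \<ge> 1" using assms by simp
  show "symmetry_group (ray_map n) = rotation_group n"
    using symmetry_group_subset_rotation_group[OF n] rotation_group_subset_symmetry_group[OF n] by blast
  show "\<exists>p. minimal_period (ray_map n) p n"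
    using minimal_period_ray_map[OF n] by blast
qed (simp_all add: ray_map_differentiable_homeomorphism Fix_ray_map[OF assms]
       ray_map_local_attractor ray_map_infinity_repellor)

end
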